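(* Let $d\ge 1$ be an integer and let $\mu$ be a $\sigma$-finite translation invariant measure defined on a translation invariant $\sigma$-algebra $\mathcal{A}$ of subsets of $\mathbb{R}^d$ containing all Borel subsets of $\mathbb{R}^d$. Then there exists $c\in[0,\infty]$ such that $\mu(B)=c\,\lambda_d(B)$ for every Borel set $B\subset\mathbb{R}^d$.
   Context: $\lambda_d$ denotes $d$-dimensional Lebesgue measure. The convention $\infty\cdot 0=0$ is used, so $\mu(B)=\infty\,\lambda_d(B)$ means: $\mu(B)=0$ if $\lambda_d(B)=0$ and $\mu(B)=\infty$ if $\lambda_d(B)>0$. A $\sigma$-algebra $\mathcal{A}$ of subsets of $\mathbb{R}^d$ is translation invariant if $A+t=\{a+t:a\in A\}\in\mathcal{A}$ for every $A\in\mathcal{A}$ and $t\in\mathbb{R}^d$; a measure $\mu$ on such an $\mathcal{A}$ is translation invariant if $\mu(A+t)=\mu(A)$ for all $A\in\mathcal{A}$, $t\in\mathbb{R}^d$. The measure $\mu$ is $\sigma$-finite if $\mathbb{R}^d$ is a countable union of members of $\mathcal{A}$ (not necessarily Borel sets) of finite $\mu$-measure. Measures take values in $[0,\infty]$. *)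

theory Defs
  imports "HOL-Analysis.Analysis"
begin

definition translation_invariant_sets :: "'a::plus set set \<Rightarrow> bool" where
  "translation_invariant_sets \<A> \<longleftrightarrow> (\<forall>A\<in>\<A>. \<forall>t. (\<lambda>a. a + t) ` A \<in> \<A>)"

(* Only meaningful when sets M is itself translation invariant, since emeasure is 0
   outside sets M; this is therefore kept as a separate hypothesis. *)
definition translation_invariant_measure :: "'a::plus measure \<Rightarrow> bool" where
  "translation_invariant_measure M \<longleftrightarrow>
     (\<forall>A\<in>sets M. \<forall>t. emeasure M ((\<lambda>a. a + t) ` A) = emeasure M A)"

end

theory Submission
  imports Defs
begin

text \<open>
  For Borel sets \<open>B\<close> and \<open>C\<close>, evaluate the double integral of
  \<open>1\<^sub>C(x) 1\<^sub>B(x - y)\<close> against \<open>\<lambda>\<^sub>d(dx) \<mu>(dy)\<close> in both orders. Integrating over \<open>y\<close> first gives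
  \<open>\<lambda>\<^sub>d(C) \<mu>(-B)\<close>. Substituting \<open>x = u + y\<close> in the inner integral and then integrating over \<open>y\<close>
  first gives \<open>\<lambda>\<^sub>d(B) \<mu>(C)\<close>. Tonelli's theorem only needs \<open>\<mu>\<close> to be \<open>\<sigma>\<close>-finite on the large
  \<open>\<sigma>\<close>-algebra, although its restriction to the Borel sets need not be. Taking \<open>B\<close> to be the
  unit cube yields \<open>c = \<mu>(-B)\<close>.
\<close>

lemma emeasure_translation_invariant_cross:
  fixes M :: "'a::euclidean_space measure"
  assumes space: "space M = UNIV"
    and borel: "sets borel \<subseteq> sets M"
    and inv: "translation_invariant_measure M"
    and sigma: "sigma_finite_measure M"
    and B: "B \<in> sets borel" and C: "C \<in> sets borel"
  shows "emeasure lborel B * emeasure M C = emeasure M (uminus ` B) * emeasure lborel C"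
proof -
  interpret sigma_finite_measure M by (fact sigma)
  interpret P: pair_sigma_finite lborel M ..
  have [measurable]: "B \<in> sets borel" "C \<in> sets borel" by (fact B, fact C)
  have shift: "emeasure M ((\<lambda>a. a + t) ` A) = emeasure M A" if "A \<in> sets borel" for A t
    using inv borel that unfolding translation_invariant_measure_def by blast
  \<comment> \<open>Composing with this identity map makes Borel functions
    \<open>M\<close>-measurable, so \<open>measurable\<close> can treat the integrands jointly on
    the product of \<open>lborel\<close> and \<open>M\<close>.\<close>
  have [measurable]: "(\<lambda>x. x) \<in> M \<rightarrow>\<^sub>M borel"
    using borel space by (auto simp: measurable_def)
  have uminus_B: "uminus ` B \<in> sets borel"
  proof -
    have "uminus -` B \<inter> space borel \<in> sets (borel :: 'a measure)" by measurable
    also have "uminus -` B \<inter> space borel = uminus ` B"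
      by (auto simp: image_iff) (metis minus_minus)
    finally show ?thesis .
  qed
  have inner_C: "(\<integral>\<^sup>+y. indicator C (u + y) \<partial>M) = emeasure M C" for u
  proof -
    have eq: "{y \<in> space M. u + y \<in> C} = (\<lambda>a. a + (- u)) ` C"
      by (auto simp: space image_iff algebra_simps intro!: bexI[where x = "u + _"])
    have "(\<integral>\<^sup>+y. indicator C (u + y) \<partial>M) = (\<integral>\<^sup>+y. indicator {y \<in> space M. u + y \<in> C} y \<partial>M)"
      by (intro nn_integral_cong) (auto simp: indicator_def)
    also have "\<dots> = emeasure M {y \<in> space M. u + y \<in> C}"
      by (rule nn_integral_indicator) measurable
    finally show ?thesis unfolding eq shift[OF C] .
  qed
  have inner_B: "(\<integral>\<^sup>+y. indicator B (x - y) \<partial>M) = emeasure M (uminus ` B)" for x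
  proof -
    \<comment> \<open>As a set of \<open>y\<close>, the section is the reflected \<open>B\<close>
      translated by \<open>x\<close>; this is where \<open>uminus\<close> enters.\<close>
    have eq: "{y \<in> space M. x - y \<in> B} = (\<lambda>a. a + x) ` uminus ` B"
      by (auto simp: space image_iff algebra_simps intro!: bexI[where x = "x - _"])
    have "(\<integral>\<^sup>+y. indicator B (x - y) \<partial>M) = (\<integral>\<^sup>+y. indicator {y \<in> space M. x - y \<in> B} y \<partial>M)"
      by (intro nn_integral_cong) (auto simp: indicator_def)
    also have "\<dots> = emeasure M {y \<in> space M. x - y \<in> B}"
      by (rule nn_integral_indicator) measurable
    finally show ?thesis unfolding eq shift[OF uminus_B] .
  qed
  have "emeasure lborel B * emeasure M C
      = (\<integral>\<^sup>+u. (\<integral>\<^sup>+y. indicator B u * indicator C (u + y) \<partial>M) \<partial>lborel)"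
    by (simp add: nn_integral_cmult inner_C nn_integral_multc)
  also have "\<dots> = (\<integral>\<^sup>+y. (\<integral>\<^sup>+u. indicator B u * indicator C (u + y) \<partial>lborel) \<partial>M)"
    by (rule P.Fubini'[symmetric]) measurable
  also have "\<dots> = (\<integral>\<^sup>+y. (\<integral>\<^sup>+x. indicator B (x - y) * indicator C x \<partial>lborel) \<partial>M)"
  proof (rule nn_integral_cong)
    fix y
    \<comment> \<open>Translation invariance of Lebesgue measure: \<open>lborel\<close> is its own
      image under \<open>(+) y\<close>.\<close>
    have "(\<integral>\<^sup>+u. indicator B u * indicator C (u + y) \<partial>lborel)
        = (\<integral>\<^sup>+x. indicator B (x - y) * indicator C x \<partial>distr lborel borel ((+) y))"
      by (subst nn_integral_distr) (auto simp: add.commute)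
    then show "(\<integral>\<^sup>+u. indicator B u * indicator C (u + y) \<partial>lborel)
        = (\<integral>\<^sup>+x. indicator B (x - y) * indicator C x \<partial>lborel)"
      by (simp add: lborel_distr_plus)
  qed
  also have "\<dots> = (\<integral>\<^sup>+x. (\<integral>\<^sup>+y. indicator B (x - y) * indicator C x \<partial>M) \<partial>lborel)"
    by (rule P.Fubini') measurable
  also have "\<dots> = emeasure M (uminus ` B) * emeasure lborel C"
    by (simp add: nn_integral_multc inner_B nn_integral_cmult)
  finally show ?thesis .
qed

theorem theorem2p1:
  fixes M :: "(real ^ 'd) measure"
  assumes "space M = UNIV"
    and "sets borel \<subseteq> sets M"
    and "translation_invariant_sets (sets M)"
    and "translation_invariant_measure M"
    and "sigma_finite_measure M"
  shows "\<exists>c::ennreal. \<forall>B\<in>sets borel. emeasure M B = c * emeasure lborel B"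
proof (intro exI ballI)
  fix C :: "(real ^ 'd) set" assume C: "C \<in> sets borel"
  let ?Q = "cbox 0 One :: (real ^ 'd) set"
  have "emeasure lborel ?Q = 1"
    by (simp add: emeasure_lborel_cbox_eq)
  \<comment> \<open>The witness left open by \<open>exI\<close> is fixed here, independently of
    \<open>C\<close>. If it is \<infinity>, the product is read with
    \<open>\<infinity> * 0 = 0\<close>.\<close>
  then show "emeasure M C = emeasure M (uminus ` ?Q) * emeasure lborel C"
    using emeasure_translation_invariant_cross[OF assms(1,2,4,5) _ C, of ?Q] by simp
qed

end
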